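(* Problem EE* gives an approximate solution to Problem EE only with the factor $q=0$: the inclusion $E(\boldsymbol v_0)\subset\mathrm{co}\{E(\boldsymbol v_1),\ldots,E(\boldsymbol v_N)\}$ does not imply the existence of a positive $q$ such that $q\boldsymbol v_0\in\mathrm{cob}\{\boldsymbol v_1,\ldots,\boldsymbol v_N\}$. That is, there exist $d,N\ge1$ and $\boldsymbol v_0,\ldots,\boldsymbol v_N\in\mathbb C^d$ such that $E(\boldsymbol v_0)\subset\mathrm{co}\{E(\boldsymbol v_1),\ldots,E(\boldsymbol v_N)\}$, but $q\boldsymbol v_0\notin\mathrm{cob}\{\boldsymbol v_1,\ldots,\boldsymbol v_N\}$ for every $q>0$.
   Context: For $\boldsymbol v=\boldsymbol a+i\boldsymbol b\in\mathbb C^d$ with $\boldsymbol a,\boldsymbol b\in\mathbb R^d$, $E(\boldsymbol v)=\{\boldsymbol a\cos t+\boldsymbol b\sin t : t\in\mathbb R\}\subset\mathbb R^d$. $\mathrm{co}$ denotes the convex hull of the union of the listed sets. The balanced convex hull of $K\subset\mathbb C^d$ is $$\mathrm{cob}(K)=\Big\{\sum_{k=1}^n z_k\boldsymbol v_k : n\in\mathbb N,\ z_k\in\mathbb C,\ \boldsymbol v_k\in K,\ \sum_{k=1}^n|z_k|\le1\Big\}.$$ Problem EE: given ellipses $E_0,\ldots,E_N$, where $E_k=E(\boldsymbol v_k)$, decide whether $E_0\subset\mathrm{co}\{E_1,\ldots,E_N\}$. Problem EE*: given $\boldsymbol v_0,\ldots,\boldsymbol v_N\in\mathbb C^d$, decide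 whether $\boldsymbol v_0\in\mathrm{cob}\{\boldsymbol v_1,\ldots,\boldsymbol v_N\}$. *)

theory Defs
  imports Complex_Main "Jordan_Normal_Form.Matrix"
begin

text \<open>
  The dimension \<open>d\<close> is quantified inside the statement, so real and complex d-space are the
  carriers \<^term>\<open>carrier_vec d\<close> of the explicitly dimensioned vectors.
\<close>

definition ellipse :: "complex vec \<Rightarrow> real vec set" where
  "ellipse v = {cos t \<cdot>\<^sub>v map_vec Re v + sin t \<cdot>\<^sub>v map_vec Im v | t :: real. True}"

text \<open>
  The type of vectors of arbitrary dimension is not a real vector space, so the
  library's constant for convexity does not apply; this is the same formula for vectors.
  The hull is then formed with the generic operator \<open>hull\<close>.  For a subset of
  \<^term>\<open>carrier_vec d\<close> it is the usual convex hull in d-space, because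
  \<^term>\<open>carrier_vec d\<close> is itself convex (lemma below) and so contains the hull.
\<close>

definition vec_convex :: "real vec set \<Rightarrow> bool" where
  "vec_convex S \<longleftrightarrow>
     (\<forall>x\<in>S. \<forall>y\<in>S. \<forall>a\<ge>0. \<forall>b\<ge>0. a + b = 1 \<longrightarrow> a \<cdot>\<^sub>v x + b \<cdot>\<^sub>v y \<in> S)"

lemma vec_convex_carrier_vec: "vec_convex (carrier_vec d)"
  by (auto simp: vec_convex_def)

definition co :: "real vec set set \<Rightarrow> real vec set" where
  "co \<E> = vec_convex hull (\<Union>\<E>)"

text \<open>
  The balanced convex hull of a set \<open>K\<close> in complex d-space; \<open>d\<close> is an argument only because the
  vector sum needs to know the dimension.  The empty sum (\<open>n = 0\<close>) adds nothing
  when \<open>K\<close> is nonempty, since then 0 is also a combination with zero coefficient.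
\<close>

definition cob :: "nat \<Rightarrow> complex vec set \<Rightarrow> complex vec set" where
  "cob d K = {finsum_vec TYPE(complex) d (\<lambda>k. z k \<cdot>\<^sub>v v k) {1..n} | (n::nat) z v.
     (\<forall>k\<in>{1..n}. v k \<in> K) \<and> (\<Sum>k=1..n. cmod (z k)) \<le> 1}"

end

theory Submission
  imports Defs
begin

text \<open>
  The ellipse \<open>E(v)\<close> only sees \<open>v\<close> up to complex conjugation, which reverses its parametrisation,
  whereas the balanced hull of a single vector is contained in its complex line.  So it suffices
  to take \<open>v\<^sub>0 = (1, i)\<close>, which is not proportional to its conjugate, and \<open>N = 1\<close> with
  \<open>v\<^sub>1 = (1, -i)\<close>.
\<close>

lemma ellipse_map_cnj: "ellipse v \<subseteq> ellipse (map_vec cnj v)"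
proof
  fix x assume "x \<in> ellipse v"
  then obtain t where "x = cos t \<cdot>\<^sub>v map_vec Re v + sin t \<cdot>\<^sub>v map_vec Im v"
    by (auto simp: ellipse_def)
  \<comment> \<open>Conjugation changes the sign of the imaginary part; since sine is odd and cosine
    even, passing from \<open>t\<close> to \<open>- t\<close> undoes this.\<close>
  then have "x = cos (- t) \<cdot>\<^sub>v map_vec Re (map_vec cnj v) + sin (- t) \<cdot>\<^sub>v map_vec Im (map_vec cnj v)"
    by (intro eq_vecI) auto
  then show "x \<in> ellipse (map_vec cnj v)"
    unfolding ellipse_def by blast
qed

text \<open>All vectors in the combination equal \<open>u\<close>, so their coefficients add up to a
  single scalar.\<close>

lemma cob_singleton_subset_line:
  assumes "u \<in> carrier_vec d" and "w \<in> cob d {u}"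
  shows "\<exists>c. w = c \<cdot>\<^sub>v u"
proof -
  from assms(2) obtain n :: nat and z v where
    w: "w = finsum_vec TYPE(complex) d (\<lambda>k. z k \<cdot>\<^sub>v v k) {1..n}" and v: "\<forall>k\<in>{1..n}. v k \<in> {u}"
    by (auto simp: cob_def)
  have carrier: "(\<lambda>k. z k \<cdot>\<^sub>v v k) \<in> {1..n} \<rightarrow> carrier_vec d"
    using v assms(1) by auto
  have "w = (\<Sum>k=1..n. z k) \<cdot>\<^sub>v u"
  proof (rule eq_vecI)
    fix j assume "j < dim_vec ((\<Sum>k=1..n. z k) \<cdot>\<^sub>v u)"
    then have j: "j < d" using assms(1) by simp
    \<comment> \<open>Coordinatewise the vector sum becomes a sum of complex numbers, from which
      \<open>u $ j\<close> factors out.\<close>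
    have "w $ j = (\<Sum>k=1..n. (z k \<cdot>\<^sub>v v k) $ j)"
      unfolding w using index_finsum_vec[OF _ j carrier] by simp
    also have "\<dots> = (\<Sum>k=1..n. z k * u $ j)"
      using v j assms(1) by (intro sum.cong) auto
    finally show "w $ j = ((\<Sum>k=1..n. z k) \<cdot>\<^sub>v u) $ j"
      using j assms(1) by (simp add: sum_distrib_right)
  next
    show "dim_vec w = dim_vec ((\<Sum>k=1..n. z k) \<cdot>\<^sub>v u)"
      using finsum_vec_closed[OF carrier] assms(1) unfolding w by simp
  qed
  then show ?thesis ..
qed

theorem proposition6p1:
  shows "\<exists>(d::nat) (N::nat) (v :: nat \<Rightarrow> complex vec).
    d \<ge> 1 \<and> N \<ge> 1 \<and> (\<forall>k\<in>{0..N}. v k \<in> carrier_vec d) \<and>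
    ellipse (v 0) \<subseteq> co ((\<lambda>k. ellipse (v k)) ` {1..N}) \<and>
    (\<forall>q::real. q > 0 \<longrightarrow> complex_of_real q \<cdot>\<^sub>v v 0 \<notin> cob d (v ` {1..N}))"
proof -
  define u where "u = vec 2 (\<lambda>j. if j = 0 then 1 else \<i>)"
  define v where "v k = (if k = 0 then u else map_vec cnj u)" for k :: nat
  have u: "map_vec cnj u \<in> carrier_vec 2" "u \<in> carrier_vec 2"
    by (simp_all add: u_def)
  \<comment> \<open>For \<open>N = 1\<close> the union is one ellipse, and every set lies in its
    hull.\<close>
  have "ellipse (v 0) \<subseteq> co ((\<lambda>k. ellipse (v k)) ` {1..1})"
    using ellipse_map_cnj[of u] by (auto simp: v_def co_def intro: hull_inc)
  moreover have "complex_of_real q \<cdot>\<^sub>v v 0 \<notin> cob 2 (v ` {1..1})" if "q > 0" for q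
  proof
    assume "complex_of_real q \<cdot>\<^sub>v v 0 \<in> cob 2 (v ` {1..1})"
    then obtain c where c: "complex_of_real q \<cdot>\<^sub>v u = c \<cdot>\<^sub>v map_vec cnj u"
      using cob_singleton_subset_line[OF u(1)] by (auto simp: v_def)
    \<comment> \<open>The entries 1 and \<i> of \<open>u\<close> turn proportionality into
      \<open>c = q\<close> and \<open>c = - q\<close>, which forces \<open>q = 0\<close>.\<close>
    have "complex_of_real q = c"
      using arg_cong[OF c, of "\<lambda>x. x $ 0"] by (simp add: u_def)
    moreover have "complex_of_real q * \<i> = - (c * \<i>)"
      using arg_cong[OF c, of "\<lambda>x. x $ 1"] by (simp add: u_def)
    ultimately show False
      using that by (simp add: complex_eq_iff)
  qed
  moreover have "\<forall>k\<in>{0..1}. v k \<in> carrier_vec 2"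
    using u by (simp add: v_def)
  ultimately show ?thesis
    by (intro exI[of _ 2] exI[of _ 1] exI[of _ v]) simp
qed

end
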